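(* The group $G_L=\langle (12),(23),(34),(67),A\rangle\leq GL(7,\mathbb{C})$ is isomorphic to the Coxeter group $W(D_5)$, which is of order $1920$.
   Context: A permutation $\sigma\in S_7$ is identified with the matrix in $GL(7,\mathbb{C})$ that permutes the standard basis by $e_i\mapsto e_{\sigma(i)}$; $(12),(23),(34),(67)$ are the corresponding transposition matrices. The matrix $A$ is $$A=\begin{pmatrix}1&0&0&0&0&0&0\\0&1&0&0&0&0&0\\0&0&-1&0&0&0&1\\0&0&0&-1&0&0&1\\0&0&-1&-1&1&0&1\\0&0&-1&-1&0&1&1\\0&0&0&0&0&0&1\end{pmatrix}.$$ The Coxeter group $W(D_5)$ is the group with presentation $\langle s_1,s_2,s_3,s_4,s_{1'} : (s_is_j)^{m_{ij}}=1\rangle$, where $m_{ii}=1$ for all $i$, and for distinct $i,j\in\{1,2,3,4,1'\}$, $m_{ij}=3$ if $i,j$ are joined by an edge of the Dynkin diagram and $m_{ij}=2$ otherwise; the edges of the diagram are $\{1,2\},\{2,3\},\{3,4\},\{1',2\}$. *)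

theory Defs
  imports
    Jordan_Normal_Form.Matrix
    "HOL-Algebra.Generated_Groups"
    "HOL-Combinatorics.Transposition"
begin

section \<open>Groups given by generators and relators\<close>

text \<open>
  A letter is a pair of a generator and a sign: \<open>(s, True)\<close> stands for \<open>s\<close> and
  \<open>(s, False)\<close> for its formal inverse.
\<close>

type_synonym 'a group_word = "('a \<times> bool) list"

definition gen_words :: "'a set \<Rightarrow> 'a group_word set" where
  "gen_words S = lists (S \<times> UNIV)"

inductive word_eq :: "'a set \<Rightarrow> 'a group_word set \<Rightarrow> 'a group_word \<Rightarrow> 'a group_word \<Rightarrow> bool"
  for S :: "'a set" and R :: "'a group_word set" where
  refl: "u \<in> gen_words S \<Longrightarrow> word_eq S R u u"
| sym: "word_eq S R u v \<Longrightarrow> word_eq S R v u"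
| trans: "word_eq S R u v \<Longrightarrow> word_eq S R v w \<Longrightarrow> word_eq S R u w"
| cancel: "u \<in> gen_words S \<Longrightarrow> v \<in> gen_words S \<Longrightarrow> s \<in> S \<Longrightarrow>
    word_eq S R (u @ [(s, b), (s, \<not> b)] @ v) (u @ v)"
| relator: "u \<in> gen_words S \<Longrightarrow> v \<in> gen_words S \<Longrightarrow> r \<in> R \<Longrightarrow> r \<in> gen_words S \<Longrightarrow>
    word_eq S R (u @ r @ v) (u @ v)"

definition word_rel :: "'a set \<Rightarrow> 'a group_word set \<Rightarrow> ('a group_word \<times> 'a group_word) set" where
  "word_rel S R = {(u, v). word_eq S R u v}"

definition presented_group :: "'a set \<Rightarrow> 'a group_word set \<Rightarrow> 'a group_word set monoid" where
  "presented_group S R =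
    \<lparr>carrier = gen_words S // word_rel S R,
     mult = (\<lambda>X Y. \<Union>u\<in>X. \<Union>v\<in>Y. word_rel S R `` {u @ v}),
     one = word_rel S R `` {[]}\<rparr>"

lemma word_eq_in_gen_words:
  "word_eq S R u v \<Longrightarrow> u \<in> gen_words S \<and> v \<in> gen_words S"
  by (induction rule: word_eq.induct) (auto simp: gen_words_def)

lemma equiv_word_rel: "equiv (gen_words S) (word_rel S R)"
proof (rule equivI)
  show "word_rel S R \<subseteq> gen_words S \<times> gen_words S"
    by (auto simp: word_rel_def dest: word_eq_in_gen_words)
  show "refl_on (gen_words S) (word_rel S R)"
    by (auto simp: refl_on_def word_rel_def intro: word_eq.refl)
  show "sym (word_rel S R)"
    by (auto simp: sym_def word_rel_def intro: word_eq.sym)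
  show "trans (word_rel S R)"
    unfolding trans_def word_rel_def by (blast intro: word_eq.trans)
qed

lemma word_eq_append_left:
  assumes "word_eq S R u v" "w \<in> gen_words S"
  shows "word_eq S R (w @ u) (w @ v)"
  using assms
proof (induction rule: word_eq.induct)
  case (cancel u v s b)
  then show ?case
    using word_eq.cancel[of "w @ u" S v s R b] by (simp add: gen_words_def)
next
  case (relator u v r)
  then show ?case
    using word_eq.relator[of "w @ u" S v r R] by (simp add: gen_words_def)
qed (auto simp: gen_words_def intro: word_eq.refl word_eq.sym word_eq.trans)

lemma word_eq_append_right:
  assumes "word_eq S R u v" "w \<in> gen_words S"
  shows "word_eq S R (u @ w) (v @ w)"
  using assms
proof (induction rule: word_eq.induct)
  case (cancel u v s b)
  then show ?case
    using word_eq.cancel[of u S "v @ w" s R b] by (simp add: gen_words_def)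
next
  case (relator u v r)
  then show ?case
    using word_eq.relator[of u S "v @ w" r R] by (simp add: gen_words_def)
qed (auto simp: gen_words_def intro: word_eq.refl word_eq.sym word_eq.trans)

lemma word_eq_append:
  assumes "word_eq S R u u'" "word_eq S R v v'"
  shows "word_eq S R (u @ v) (u' @ v')"
  using assms by (meson word_eq.trans word_eq_append_left word_eq_append_right word_eq_in_gen_words)

lemma mult_presented_group:
  assumes "u \<in> gen_words S" "v \<in> gen_words S"
  shows "word_rel S R `` {u} \<otimes>\<^bsub>presented_group S R\<^esub> word_rel S R `` {v} = word_rel S R `` {u @ v}"
proof -
  have cong: "(\<lambda>x y. word_rel S R `` {x @ y}) respects2 word_rel S R"
    by (rule congruent2I', rule equiv_class_eq[OF equiv_word_rel])
      (simp add: word_rel_def word_eq_append)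
  show ?thesis
    using UN_equiv_class2[OF equiv_word_rel equiv_word_rel cong assms]
    by (simp add: presented_group_def)
qed

lemma word_inverse:
  assumes "u \<in> gen_words S"
  shows "word_eq S R (rev (map (\<lambda>(s, b). (s, \<not> b)) u) @ u) []"
  using assms
proof (induction u)
  case Nil
  then show ?case by (auto simp: gen_words_def intro: word_eq.refl)
next
  case (Cons a u)
  obtain s b where a: "a = (s, b)" by (cases a)
  let ?i = "rev (map (\<lambda>(s, b). (s, \<not> b)) u)"
  have mem: "s \<in> S" "u \<in> gen_words S" "?i \<in> gen_words S"
    using Cons.prems by (auto simp: a gen_words_def)
  have "word_eq S R (?i @ [(s, \<not> b), (s, \<not> \<not> b)] @ u) (?i @ u)"
    by (rule word_eq.cancel) (use mem in auto)
  with Cons.IH[OF mem(2)] show ?case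
    by (auto simp: a intro: word_eq.trans)
qed

lemma group_presented_group: "group (presented_group S R)"
proof (rule groupI)
  let ?G = "presented_group S R"
  have carr: "carrier ?G = gen_words S // word_rel S R"
    by (simp add: presented_group_def)
  have one: "\<one>\<^bsub>?G\<^esub> = word_rel S R `` {[]}"
    by (simp add: presented_group_def)
  have nil: "[] \<in> gen_words S"
    by (simp add: gen_words_def)
  have app: "u @ v \<in> gen_words S" if "u \<in> gen_words S" "v \<in> gen_words S" for u v
    using that by (simp add: gen_words_def)
  show "\<one>\<^bsub>?G\<^esub> \<in> carrier ?G"
    unfolding carr one by (rule quotientI[OF nil])
  fix x assume "x \<in> carrier ?G"
  then obtain u where u: "u \<in> gen_words S" "x = word_rel S R `` {u}"
    unfolding carr by (auto elim: quotientE)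
  show "\<one>\<^bsub>?G\<^esub> \<otimes>\<^bsub>?G\<^esub> x = x"
    by (simp add: one u mult_presented_group nil)
  let ?i = "rev (map (\<lambda>(s, b). (s, \<not> b)) u)"
  have i: "?i \<in> gen_words S"
    using u(1) by (auto simp: gen_words_def)
  have "word_rel S R `` {?i} \<otimes>\<^bsub>?G\<^esub> x = \<one>\<^bsub>?G\<^esub>"
    unfolding one u(2) mult_presented_group[OF i u(1)]
    by (rule equiv_class_eq[OF equiv_word_rel]) (simp add: word_rel_def word_inverse[OF u(1)])
  then show "\<exists>y\<in>carrier ?G. y \<otimes>\<^bsub>?G\<^esub> x = \<one>\<^bsub>?G\<^esub>"
    unfolding carr using quotientI[OF i] by blast
  fix y assume "y \<in> carrier ?G"
  then obtain v where v: "v \<in> gen_words S" "y = word_rel S R `` {v}"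
    unfolding carr by (auto elim: quotientE)
  show "x \<otimes>\<^bsub>?G\<^esub> y \<in> carrier ?G"
    unfolding carr using u v by (simp add: mult_presented_group quotientI app)
  fix z assume "z \<in> carrier ?G"
  then obtain w where w: "w \<in> gen_words S" "z = word_rel S R `` {w}"
    unfolding carr by (auto elim: quotientE)
  show "(x \<otimes>\<^bsub>?G\<^esub> y) \<otimes>\<^bsub>?G\<^esub> z = x \<otimes>\<^bsub>?G\<^esub> (y \<otimes>\<^bsub>?G\<^esub> z)"
    using u v w by (simp add: mult_presented_group app)
qed


section \<open>Coxeter groups\<close>

definition coxeter_relators :: "'a set \<Rightarrow> ('a \<Rightarrow> 'a \<Rightarrow> nat) \<Rightarrow> 'a group_word set" where
  "coxeter_relators S m =
    {concat (replicate (m i j) [(i, True), (j, True)]) | i j. i \<in> S \<and> j \<in> S}"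

text \<open>An entry \<open>m i j = 0\<close> encodes \<open>\<infinity>\<close>: its relator is the empty word.\<close>

definition coxeter_group :: "'a set \<Rightarrow> ('a \<Rightarrow> 'a \<Rightarrow> nat) \<Rightarrow> 'a group_word set monoid" where
  "coxeter_group S m = presented_group S (coxeter_relators S m)"

datatype D5_node = N1 | N2 | N3 | N4 | N1'

definition D5_edges :: "D5_node set set" where
  "D5_edges = {{N1, N2}, {N2, N3}, {N3, N4}, {N1', N2}}"

definition D5_matrix :: "D5_node \<Rightarrow> D5_node \<Rightarrow> nat" where
  "D5_matrix i j = (if i = j then 1 else if {i, j} \<in> D5_edges then 3 else 2)"

definition W_D5 :: "D5_node group_word set monoid" where
  "W_D5 = coxeter_group UNIV D5_matrix"


section \<open>The matrix group\<close>

definition GL :: "nat \<Rightarrow> complex mat monoid" where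
  "GL n = units_of (ring_mat TYPE(complex) n ())"

text \<open>
  The matrix of \<open>e\<^sub>i \<mapsto> e\<^bsub>\<sigma>(i)\<^esub>\<close> for a permutation \<open>\<sigma>\<close> of \<open>{1..n}\<close>. Matrix indices
  start at 0, hence the shift by \<open>Suc\<close>.
\<close>

definition perm_matrix :: "nat \<Rightarrow> (nat \<Rightarrow> nat) \<Rightarrow> complex mat" where
  "perm_matrix n \<sigma> = mat n n (\<lambda>(i, j). if Suc i = \<sigma> (Suc j) then 1 else 0)"

definition A_matrix :: "complex mat" where
  "A_matrix = mat_of_rows_list 7
    [[1, 0,  0,  0, 0, 0, 0],
     [0, 1,  0,  0, 0, 0, 0],
     [0, 0, -1,  0, 0, 0, 1],
     [0, 0,  0, -1, 0, 0, 1],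
     [0, 0, -1, -1, 1, 0, 1],
     [0, 0, -1, -1, 0, 1, 1],
     [0, 0,  0,  0, 0, 0, 1]]"

definition G_L_gens :: "complex mat set" where
  "G_L_gens =
    {perm_matrix 7 (transpose 1 2), perm_matrix 7 (transpose 2 3),
     perm_matrix 7 (transpose 3 4), perm_matrix 7 (transpose 6 7), A_matrix}"

definition G_L :: "complex mat monoid" where
  "G_L = (GL 7)\<lparr>carrier := generate (GL 7) G_L_gens\<rparr>"

end

theory Submission
  imports Defs
begin

text \<open>
  The nodes \<open>1, 2, 1', 3, 4\<close> correspond to \<open>(12), (23), (34), (34)A, (67)\<close>; these matrices satisfy
  the Coxeter relations, which gives a homomorphism from \<open>W(D\<^sub>5)\<close> onto \<open>G\<^sub>L\<close>. Along the chain
  of parabolic subgroups \<open>A\<^sub>1 < A\<^sub>2 < A\<^sub>3 < D\<^sub>4 < D\<^sub>5\<close>, left transversals of sizes 2, 3, 4, 8, 10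
  give every element a normal form, a product of five representatives. At each stage some vector is
  fixed by the smaller subgroup and is moved by the representatives to pairwise distinct vectors;
  hence distinct normal forms have distinct images. So the homomorphism is injective, and there are
  exactly \<open>2 \<cdot> 3 \<cdot> 4 \<cdot> 8 \<cdot> 10 = 1920\<close> elements.
\<close>

section \<open>Homomorphisms out of a presented group\<close>

definition word_eval :: "('g, 'm) monoid_scheme \<Rightarrow> ('a \<Rightarrow> 'g) \<Rightarrow> 'a group_word \<Rightarrow> 'g" where
  "word_eval H f u =
    foldr (\<lambda>(s, b) x. (if b then f s else inv\<^bsub>H\<^esub> f s) \<otimes>\<^bsub>H\<^esub> x) u \<one>\<^bsub>H\<^esub>"

lemma word_eval_simps [simp]:
  "word_eval H f [] = \<one>\<^bsub>H\<^esub>"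
  "word_eval H f ((s, b) # u) = (if b then f s else inv\<^bsub>H\<^esub> f s) \<otimes>\<^bsub>H\<^esub> word_eval H f u"
  by (simp_all add: word_eval_def)

text \<open>When the relators evaluate to one, \<open>word_eval\<close> is constant on each class,
  so the image is a singleton and \<open>the_elem\<close> extracts its member without choosing a
  representative.\<close>

definition presented_lift :: "('g, 'm) monoid_scheme \<Rightarrow> ('a \<Rightarrow> 'g) \<Rightarrow> 'a group_word set \<Rightarrow> 'g" where
  "presented_lift H f X = the_elem (word_eval H f ` X)"

context group
begin

lemma word_eval_closed:
  assumes "f \<in> S \<rightarrow> carrier G" "u \<in> gen_words S"
  shows "word_eval G f u \<in> carrier G"
  using assms(2)
proof (induction u)
  case (Cons p u)
  then show ?case
    using assms(1) by (cases p) (auto simp: gen_words_def)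
qed simp

lemma word_eval_append:
  assumes "f \<in> S \<rightarrow> carrier G" "u \<in> gen_words S" "v \<in> gen_words S"
  shows "word_eval G f (u @ v) = word_eval G f u \<otimes> word_eval G f v"
  using assms(2)
proof (induction u)
  case Nil
  then show ?case
    using assms by (simp add: word_eval_closed)
next
  case (Cons p u)
  obtain s b where p: "p = (s, b)" by (cases p)
  have "s \<in> S" "u \<in> gen_words S"
    using Cons.prems by (auto simp: p gen_words_def)
  moreover from this have "f s \<in> carrier G" "word_eval G f u \<in> carrier G" "word_eval G f v \<in> carrier G"
    using assms by (auto intro: word_eval_closed)
  ultimately show ?case
    using Cons.IH by (simp add: p m_assoc)
qed

text \<open>The core of von Dyck's theorem: \<open>cancel\<close> and \<open>relator\<close> only
  delete a subword of value one.\<close>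

lemma word_eval_word_eq:
  assumes f: "f \<in> S \<rightarrow> carrier G"
    and R: "\<And>r. r \<in> R \<Longrightarrow> r \<in> gen_words S \<Longrightarrow> word_eval G f r = \<one>"
    and "word_eq S R u v"
  shows "word_eval G f u = word_eval G f v"
  using assms(3)
proof (induction rule: word_eq.induct)
  case (cancel u v s b)
  have fs: "f s \<in> carrier G"
    using f cancel by auto
  have "word_eval G f ([(s, b), (s, \<not> b)] @ v) = word_eval G f v"
    using fs word_eval_closed[OF f cancel(2)] by (cases b) (simp_all add: m_assoc[symmetric])
  moreover have "[(s, b), (s, \<not> b)] @ v \<in> gen_words S"
    using cancel by (simp add: gen_words_def)
  ultimately show ?case
    using cancel by (simp add: word_eval_append[OF f] del: append.simps)
next
  case (relator u v r)
  have "r @ v \<in> gen_words S"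
    using relator by (simp add: gen_words_def)
  then show ?case
    using relator R by (simp add: word_eval_append[OF f] word_eval_closed[OF f])
qed simp_all

lemma presented_lift_class:
  assumes f: "f \<in> S \<rightarrow> carrier G"
    and R: "\<And>r. r \<in> R \<Longrightarrow> r \<in> gen_words S \<Longrightarrow> word_eval G f r = \<one>"
    and u: "u \<in> gen_words S"
  shows "presented_lift G f (word_rel S R `` {u}) = word_eval G f u"
proof -
  have "word_eval G f v = word_eval G f u" if "v \<in> word_rel S R `` {u}" for v
    using that word_eval_word_eq[OF f R, where u = u and v = v] by (simp add: word_rel_def)
  moreover have "u \<in> word_rel S R `` {u}"
    using word_eq.refl[OF u] by (simp add: word_rel_def)
  ultimately have "word_eval G f ` (word_rel S R `` {u}) = {word_eval G f u}"
    by blast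
  then show ?thesis
    by (simp add: presented_lift_def)
qed

lemma presented_lift_hom:
  assumes f: "f \<in> S \<rightarrow> carrier G"
    and R: "\<And>r. r \<in> R \<Longrightarrow> r \<in> gen_words S \<Longrightarrow> word_eval G f r = \<one>"
  shows "presented_lift G f \<in> hom (presented_group S R) G"
proof (rule homI)
  fix x y
  assume "x \<in> carrier (presented_group S R)" "y \<in> carrier (presented_group S R)"
  then obtain u v where u: "u \<in> gen_words S" "x = word_rel S R `` {u}"
    and v: "v \<in> gen_words S" "y = word_rel S R `` {v}"
    by (auto simp: presented_group_def elim!: quotientE)
  have "u @ v \<in> gen_words S"
    using u v by (simp add: gen_words_def)
  then show "presented_lift G f (x \<otimes>\<^bsub>presented_group S R\<^esub> y) = presented_lift G f x \<otimes> presented_lift G f y"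
    using u v by (simp add: mult_presented_group presented_lift_class[OF f R] word_eval_append[OF f])
  show "presented_lift G f x \<in> carrier G"
    using u by (simp add: presented_lift_class[OF f R] word_eval_closed[OF f])
qed

lemma word_eval_replicate:
  assumes "f i \<in> carrier G" "f j \<in> carrier G"
  shows "word_eval G f (concat (replicate n [(i, True), (j, True)])) = (f i \<otimes> f j) [^] n"
proof (induction n)
  case (Suc n)
  have "word_eval G f (concat (replicate (Suc n) [(i, True), (j, True)])) = (f i \<otimes> f j) \<otimes> (f i \<otimes> f j) [^] n"
    using assms Suc by (simp add: m_assoc)
  also have "\<dots> = (f i \<otimes> f j) [^] Suc n"
    using assms by (metis m_closed nat_pow_Suc2)
  finally show ?case .
qed simp

end

text \<open>Identifies the Coxeter relators with the powers in \<open>g_rel\<close> below when the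
  group is the presented group itself.\<close>

lemma word_class_pow:
  assumes "i \<in> S" "j \<in> S"
  shows "(word_rel S R `` {[(i, True)]} \<otimes>\<^bsub>presented_group S R\<^esub> word_rel S R `` {[(j, True)]})
           [^]\<^bsub>presented_group S R\<^esub> n
         = word_rel S R `` {concat (replicate n [(i, True), (j, True)])}"
proof (induction n)
  case 0
  then show ?case
    by (simp add: presented_group_def)
next
  case (Suc n)
  have mem: "[(i, True), (j, True)] \<in> gen_words S" "[(i, True)] \<in> gen_words S" "[(j, True)] \<in> gen_words S"
    "concat (replicate n [(i, True), (j, True)]) \<in> gen_words S"
    using assms by (auto simp: gen_words_def in_lists_conv_set split: if_splits)
  \<comment> \<open>\<open>nat_pow\<close> appends the new factor on the right,
    \<open>replicate\<close> puts it on the left.\<close>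
  have comm: "concat (replicate n xs) @ xs = xs @ concat (replicate n xs)" for xs :: "('a \<times> bool) list"
    by (induction n) auto
  show ?case
    using mem Suc by (simp add: mult_presented_group comm nat_pow_def)
qed

section \<open>Transversals\<close>

context group
begin

text \<open>Either \<open>s\<close> moves the representative \<open>w\<close> to another one, or it
  preserves the coset of \<open>w\<close>; then it passes through \<open>w\<close> as some
  \<open>s'\<close>, which \<open>N\<close> absorbs. Minimal representatives of parabolic cosets in
  a Coxeter group obey this dichotomy (Deodhar's lemma).\<close>

lemma set_mult_transversal_closed:
  assumes "T \<subseteq> carrier G" "N \<subseteq> carrier G" "S' \<subseteq> carrier G" "s \<in> carrier G"
    and step: "\<And>w. w \<in> T \<Longrightarrow> s \<otimes> w \<in> T \<or> (\<exists>s'\<in>S'. s \<otimes> w = w \<otimes> s')"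
    and N: "\<And>s' u. s' \<in> S' \<Longrightarrow> u \<in> N \<Longrightarrow> s' \<otimes> u \<in> N"
    and x: "x \<in> T <#> N"
  shows "s \<otimes> x \<in> T <#> N"
proof -
  obtain w u where x: "w \<in> T" "u \<in> N" "x = w \<otimes> u"
    using x by (auto simp: set_mult_def)
  with assms have mem: "w \<in> carrier G" "u \<in> carrier G"
    by auto
  from step[OF x(1)] show ?thesis
  proof
    assume "s \<otimes> w \<in> T"
    then show ?thesis
      using x mem assms(4) by (auto simp: set_mult_def m_assoc[symmetric])
  next
    assume "\<exists>s'\<in>S'. s \<otimes> w = w \<otimes> s'"
    then obtain s' where s': "s' \<in> S'" "s \<otimes> w = w \<otimes> s'" by blast
    then have "s \<otimes> x = w \<otimes> (s' \<otimes> u)"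
      using x mem assms(3,4) by (metis m_assoc subsetD)
    then show ?thesis
      using N[OF s'(1) x(2)] x(1) by (auto simp: set_mult_def)
  qed
qed

text \<open>\<open>p\<close> will be evaluation at a vector. By \<open>stab\<close> it sees only the
  factor \<open>w\<close> of \<open>w \<otimes> u\<close>, and by \<open>dist\<close> it determines
  \<open>w\<close>; cancelling \<open>h w\<close> leaves \<open>h u\<close>, which determines
  \<open>u\<close>.\<close>

lemma set_mult_transversal_inj:
  assumes H: "group H" and h: "h \<in> hom G H"
    and TN: "set ws \<subseteq> carrier G" "N \<subseteq> carrier G"
    and N: "inj_on h N"
    and stab: "\<And>w u. w \<in> set ws \<Longrightarrow> u \<in> N \<Longrightarrow> p (h w \<otimes>\<^bsub>H\<^esub> h u) = p (h w)"
    and dist: "distinct (map (\<lambda>w. p (h w)) ws)"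
  shows "inj_on h (set ws <#> N) \<and> card (set ws <#> N) = length ws * card N"
proof -
  interpret H: group H by (rule H)
  have inj: "inj_on (\<lambda>w. p (h w)) (set ws)" and "distinct ws"
    using dist by (auto simp: distinct_map)
  have *: "w = w' \<and> u = u'"
    if "w \<in> set ws" "w' \<in> set ws" "u \<in> N" "u' \<in> N" "h (w \<otimes> u) = h (w' \<otimes> u')" for w w' u u'
  proof -
    have mem: "w \<in> carrier G" "u \<in> carrier G" "w' \<in> carrier G" "u' \<in> carrier G"
      using that TN by auto
    then have eq: "h w \<otimes>\<^bsub>H\<^esub> h u = h w' \<otimes>\<^bsub>H\<^esub> h u'"
      using that(5) by (simp add: hom_mult[OF h])
    then have "p (h w) = p (h w')"
      using stab[OF that(1,3)] stab[OF that(2,4)] by simp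
    then have "w = w'"
      using inj that by (auto dest: inj_onD)
    moreover have "h u = h u'"
      using eq mem by (simp add: \<open>w = w'\<close> hom_in_carrier[OF h])
    ultimately show ?thesis
      using N that by (auto dest: inj_onD)
  qed
  have "inj_on h (set ws <#> N)"
  proof (rule inj_onI)
    fix x y assume "x \<in> set ws <#> N" "y \<in> set ws <#> N" and eq: "h x = h y"
    then obtain w u w' u' where "w \<in> set ws" "u \<in> N" "w' \<in> set ws" "u' \<in> N"
      and xy: "x = w \<otimes> u" "y = w' \<otimes> u'"
      unfolding set_mult_def by blast
    with *[of w w' u u'] eq show "x = y" by simp
  qed
  \<comment> \<open>Equal products have equal images under \<open>h\<close>, so \<open>*\<close>
    also makes the factorization unique; this gives the cardinality.\<close>
  moreover have "inj_on (\<lambda>(w, u). w \<otimes> u) (set ws \<times> N)"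
  proof (rule inj_onI, clarify)
    fix w u w' u' assume "w \<in> set ws" "u \<in> N" "w' \<in> set ws" "u' \<in> N" "w \<otimes> u = w' \<otimes> u'"
    with *[of w w' u u'] show "w = w' \<and> u = u'" by simp
  qed
  then have "card ((\<lambda>(w, u). w \<otimes> u) ` (set ws \<times> N)) = length ws * card N"
    by (simp add: card_image card_cartesian_product distinct_card[OF \<open>distinct ws\<close>])
  moreover have "(\<lambda>(w, u). w \<otimes> u) ` (set ws \<times> N) = set ws <#> N"
    by (auto simp: set_mult_def)
  ultimately show ?thesis
    by simp
qed

end

section \<open>Normal forms\<close>

locale D5_generated = group +
  fixes g :: "D5_node \<Rightarrow> 'a"
  assumes g_closed [simp]: "g i \<in> carrier G"
    and g_rel: "(g i \<otimes> g j) [^] D5_matrix i j = \<one>"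
begin

text \<open>\<open>b\<close> is the branch node of the diagram; \<open>a\<close> and
  \<open>c\<close> are the two short legs, \<open>t\<close> and \<open>d\<close> form the long
  one.\<close>

abbreviation "a \<equiv> g N1"
abbreviation "b \<equiv> g N2"
abbreviation "c \<equiv> g N1'"
abbreviation "t \<equiv> g N3"
abbreviation "d \<equiv> g N4"

section \<open>Coxeter relations as rewrite rules\<close>

lemma g_sq [simp]: "g i \<otimes> g i = \<one>"
  using g_rel[of i i] by (simp add: D5_matrix_def)

lemma g_cancel [simp]: "x \<in> carrier G \<Longrightarrow> g i \<otimes> (g i \<otimes> x) = x"
  by (simp add: m_assoc[symmetric])

lemma inv_g: "inv (g i) = g i"
  by (simp add: inv_equality)

text \<open>The free tail \<open>x\<close> lets the relation rewrite in the middle of a right-nested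
  product.\<close>

lemma g_commute:
  assumes "D5_matrix i j = 2" "x \<in> carrier G"
  shows "g i \<otimes> (g j \<otimes> x) = g j \<otimes> (g i \<otimes> x)"
proof -
  have "g i \<otimes> (g j \<otimes> (g i \<otimes> g j)) = \<one>"
    using g_rel[of i j] assms by (simp add: numeral_2_eq_2 m_assoc)
  then have "g i \<otimes> g j = g j \<otimes> g i"
    by (metis g_cancel g_closed m_closed r_one)
  then show ?thesis
    using assms by (simp add: m_assoc[symmetric])
qed

lemma g_braid:
  assumes "D5_matrix i j = 3" "x \<in> carrier G"
  shows "g i \<otimes> (g j \<otimes> (g i \<otimes> x)) = g j \<otimes> (g i \<otimes> (g j \<otimes> x))"
proof -
  have "g i \<otimes> (g j \<otimes> (g i \<otimes> (g j \<otimes> (g i \<otimes> g j)))) = \<one>"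
    using g_rel[of i j] assms by (simp add: numeral_3_eq_3 m_assoc)
  then have "g i \<otimes> (g j \<otimes> g i) = g j \<otimes> (g i \<otimes> g j)"
    by (metis g_cancel g_closed m_closed r_one)
  then show ?thesis
    using assms by (simp add: m_assoc[symmetric])
qed

lemma D5_matrix_simps:
  "D5_matrix N1 N1' = 2" "D5_matrix N1' N1 = 2"
  "D5_matrix N1 N3 = 2" "D5_matrix N3 N1 = 2"
  "D5_matrix N1' N3 = 2" "D5_matrix N3 N1' = 2"
  "D5_matrix N1 N4 = 2" "D5_matrix N4 N1 = 2"
  "D5_matrix N1' N4 = 2" "D5_matrix N4 N1' = 2"
  "D5_matrix N2 N4 = 2" "D5_matrix N4 N2 = 2"
  "D5_matrix N1 N2 = 3" "D5_matrix N2 N1 = 3"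
  "D5_matrix N1' N2 = 3" "D5_matrix N2 N1' = 3"
  "D5_matrix N3 N2 = 3" "D5_matrix N2 N3 = 3"
  "D5_matrix N3 N4 = 3" "D5_matrix N4 N3 = 3"
  by (auto simp: D5_matrix_def D5_edges_def doubleton_eq_iff)

lemmas order_simps = g_commute[of N1' N1] g_commute[of N3 N1] g_commute[of N3 N1']
  g_commute[of N4 N1] g_commute[of N4 N1'] g_commute[of N4 N2]

lemmas braid_simps = g_braid[of N2 N1] g_braid[of N2 N1'] g_braid[of N3 N2] g_braid[of N4 N3]

text \<open>
  Together with \<open>g_cancel\<close>, \<open>order_simps\<close> and \<open>braid_simps\<close>, the next five lemmas form the
  complete rewriting system for the shortlex order with \<open>a < c < b < t < d\<close>. Their proofs
  rewrite with some of the defining relations reversed.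
\<close>

lemmas unorder_simps = g_commute[of N1 N3] g_commute[of N1' N3] g_commute[of N1 N4] g_commute[of N1' N4]
  g_commute[of N2 N4]

text \<open>On each left-hand side the last letter before \<open>x\<close> commutes back to just
  behind the second letter, which creates \<open>t b t\<close> or \<open>d t d\<close> and permits a
  braid move.\<close>

lemma shift_simps:
  assumes "x \<in> carrier G"
  shows
    "t \<otimes> (b \<otimes> (a \<otimes> (t \<otimes> x))) = b \<otimes> (t \<otimes> (b \<otimes> (a \<otimes> x)))"
    "t \<otimes> (b \<otimes> (c \<otimes> (t \<otimes> x))) = b \<otimes> (t \<otimes> (b \<otimes> (c \<otimes> x)))"
    "t \<otimes> (b \<otimes> (a \<otimes> (c \<otimes> (t \<otimes> x)))) = b \<otimes> (t \<otimes> (b \<otimes> (a \<otimes> (c \<otimes> x))))"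
    "d \<otimes> (t \<otimes> (b \<otimes> (d \<otimes> x))) = t \<otimes> (d \<otimes> (t \<otimes> (b \<otimes> x)))"
    "d \<otimes> (t \<otimes> (b \<otimes> (a \<otimes> (d \<otimes> x)))) = t \<otimes> (d \<otimes> (t \<otimes> (b \<otimes> (a \<otimes> x))))"
    "d \<otimes> (t \<otimes> (b \<otimes> (c \<otimes> (d \<otimes> x)))) = t \<otimes> (d \<otimes> (t \<otimes> (b \<otimes> (c \<otimes> x))))"
    "d \<otimes> (t \<otimes> (b \<otimes> (a \<otimes> (c \<otimes> (d \<otimes> x))))) =
       t \<otimes> (d \<otimes> (t \<otimes> (b \<otimes> (a \<otimes> (c \<otimes> x)))))"
    "d \<otimes> (t \<otimes> (b \<otimes> (a \<otimes> (c \<otimes> (b \<otimes> (d \<otimes> x)))))) =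
       t \<otimes> (d \<otimes> (t \<otimes> (b \<otimes> (a \<otimes> (c \<otimes> (b \<otimes> x))))))"
  using assms
  by (simp_all add: D5_matrix_simps unorder_simps g_braid[of N3 N2] g_braid[of N4 N3])

text \<open>After \<open>a c = c a\<close>, this is
  \<open>b c (a b a) = (b c b) a b = c b c a b\<close>.\<close>

lemma bacba:
  assumes "x \<in> carrier G"
  shows "b \<otimes> (a \<otimes> (c \<otimes> (b \<otimes> (a \<otimes> x)))) = c \<otimes> (b \<otimes> (a \<otimes> (c \<otimes> (b \<otimes> x))))"
  using assms
  by (simp add: D5_matrix_simps g_commute[of N1 N1'] g_braid[of N1 N2] g_braid[of N2 N1'])

text \<open>The counterpart of \<open>bacba\<close> under the diagram symmetry exchanging
  \<open>a\<close> and \<open>c\<close>: \<open>b a (c b c) = (b a b) c b\<close>.\<close>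

lemma bacbc:
  assumes "x \<in> carrier G"
  shows "b \<otimes> (a \<otimes> (c \<otimes> (b \<otimes> (c \<otimes> x)))) = a \<otimes> (b \<otimes> (a \<otimes> (c \<otimes> (b \<otimes> x))))"
  using assms
  by (simp add: D5_matrix_simps g_commute[of N1' N1] g_braid[of N1' N2] g_braid[of N2 N1])

text \<open>The final \<open>b t b\<close> becomes \<open>t b t\<close>; its first \<open>t\<close>
  commutes past \<open>a c\<close> and completes \<open>t b t\<close> with the two leading
  letters.\<close>

lemma tbacbtb:
  assumes "x \<in> carrier G"
  shows "t \<otimes> (b \<otimes> (a \<otimes> (c \<otimes> (b \<otimes> (t \<otimes> (b \<otimes> x)))))) =
     b \<otimes> (t \<otimes> (b \<otimes> (a \<otimes> (c \<otimes> (b \<otimes> (t \<otimes> x))))))"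
  \<comment> \<open>Both directions of the braid relation occur, each for a single tail, since
    unrestricted they would undo each other forever.\<close>
  using assms g_braid[of N3 N2 "a \<otimes> (c \<otimes> (b \<otimes> (t \<otimes> x)))"]
  by (simp add: D5_matrix_simps unorder_simps g_braid[of N2 N3 x])

text \<open>The pattern of \<open>tbacbtb\<close> one node further: \<open>t d t\<close> becomes
  \<open>d t d\<close>, and its first \<open>d\<close> commutes past \<open>b a c b\<close>.\<close>

lemma dtbacbtdt:
  assumes "x \<in> carrier G"
  shows "d \<otimes> (t \<otimes> (b \<otimes> (a \<otimes> (c \<otimes> (b \<otimes> (t \<otimes> (d \<otimes> (t \<otimes> x)))))))) =
     t \<otimes> (d \<otimes> (t \<otimes> (b \<otimes> (a \<otimes> (c \<otimes> (b \<otimes> (t \<otimes> (d \<otimes> x))))))))"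
  using assms g_braid[of N4 N3 "b \<otimes> (a \<otimes> (c \<otimes> (b \<otimes> (t \<otimes> (d \<otimes> x)))))"]
  by (simp add: D5_matrix_simps unorder_simps g_braid[of N3 N4 x])

fun lmul :: "D5_node list \<Rightarrow> 'a \<Rightarrow> 'a" where
  "lmul [] x = x"
| "lmul (i # w) x = g i \<otimes> lmul w x"

lemma lmul_closed [simp]: "x \<in> carrier G \<Longrightarrow> lmul w x \<in> carrier G"
  by (induction w) auto

end

text \<open>
  \<open>reps n\<close> lists the left coset representatives, in the parabolic subgroup generated by the nodes
  up to \<open>n\<close> in the order \<open>1, 2, 1', 3, 4\<close>, of the subgroup generated by the nodes before \<open>n\<close>.
\<close>

fun reps :: "D5_node \<Rightarrow> D5_node list list" where
  "reps N1 = [[], [N1]]"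
| "reps N2 = [[], [N2], [N1, N2]]"
| "reps N1' = [[], [N1'], [N2, N1'], [N1, N2, N1']]"
| "reps N3 = [[], [N3], [N2, N3], [N1, N2, N3], [N1', N2, N3], [N1, N1', N2, N3],
     [N2, N1, N1', N2, N3], [N3, N2, N1, N1', N2, N3]]"
| "reps N4 = [[], [N4], [N3, N4], [N2, N3, N4], [N1, N2, N3, N4], [N1', N2, N3, N4],
     [N1, N1', N2, N3, N4], [N2, N1, N1', N2, N3, N4], [N3, N2, N1, N1', N2, N3, N4],
     [N4, N3, N2, N1, N1', N2, N3, N4]]"

declare reps.simps [simp del]

context D5_generated
begin

lemmas rewrite_simps = D5_matrix_simps order_simps braid_simps
  shift_simps bacba bacbc tbacbtb dtbacbtdt

text \<open>
  The tail \<open>x\<close> is arbitrary because the rewrite rules apply only to products with a tail; for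
  \<open>x = \<one>\<close> the simplifier would drop it.
\<close>

lemma reps_step:
  assumes "x \<in> carrier G"
  shows
    "\<forall>w\<in>set (reps N1). lmul (N1 # w) x \<in> (\<lambda>w. lmul w x) ` set (reps N1)"
    "\<forall>i\<in>{N1, N2}. \<forall>w\<in>set (reps N2). lmul (i # w) x \<in> (\<lambda>w. lmul w x) ` set (reps N2) \<or>
       (\<exists>j\<in>{N1}. lmul (i # w) x = lmul (w @ [j]) x)"
    "\<forall>i\<in>{N1, N2, N1'}. \<forall>w\<in>set (reps N1'). lmul (i # w) x \<in> (\<lambda>w. lmul w x) ` set (reps N1') \<or>
       (\<exists>j\<in>{N1, N2}. lmul (i # w) x = lmul (w @ [j]) x)"
    "\<forall>i\<in>{N1, N2, N1', N3}. \<forall>w\<in>set (reps N3). lmul (i # w) x \<in> (\<lambda>w. lmul w x) ` set (reps N3) \<or>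
       (\<exists>j\<in>{N1, N2, N1'}. lmul (i # w) x = lmul (w @ [j]) x)"
    "\<forall>i\<in>{N1, N2, N1', N3, N4}. \<forall>w\<in>set (reps N4). lmul (i # w) x \<in> (\<lambda>w. lmul w x) ` set (reps N4) \<or>
       (\<exists>j\<in>{N1, N2, N1', N3}. lmul (i # w) x = lmul (w @ [j]) x)"
  \<comment> \<open>A finite check: in every case the two sides of some alternative rewrite to the
    same term.\<close>
  using assms by (simp_all add: rewrite_simps reps.simps)

lemma lmul_snoc: "lmul (w @ [j]) \<one> = lmul w \<one> \<otimes> g j"
  by (induction w) (simp_all add: m_assoc)

section \<open>Products of coset representatives\<close>

abbreviation level :: "D5_node \<Rightarrow> 'a set" where
  "level n \<equiv> (\<lambda>w. lmul w \<one>) ` set (reps n)"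

lemma level_set_mult_closed:
  assumes step: "\<forall>i\<in>I. \<forall>w\<in>set (reps n). lmul (i # w) \<one> \<in> level n \<or>
      (\<exists>j\<in>J. lmul (i # w) \<one> = lmul (w @ [j]) \<one>)"
    and N: "N \<subseteq> carrier G" "\<forall>j\<in>J. \<forall>u\<in>N. g j \<otimes> u \<in> N"
  shows "\<forall>i\<in>I. \<forall>x\<in>level n <#> N. g i \<otimes> x \<in> level n <#> N"
proof (intro ballI)
  fix i x assume i: "i \<in> I" and x: "x \<in> level n <#> N"
  show "g i \<otimes> x \<in> level n <#> N"
  proof (rule set_mult_transversal_closed[OF _ N(1) _ _ _ _ x, of "g ` J"])
    fix w assume "w \<in> level n"
    then show "g i \<otimes> w \<in> level n \<or> (\<exists>s'\<in>g ` J. g i \<otimes> w = w \<otimes> s')"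
      using step i by (fastforce simp: lmul_snoc)
  qed (use N(2) in auto)
qed

text \<open>The indices count stages of the parabolic chain, not nodes: the third stage adds
  \<open>N1'\<close>, the fourth \<open>N3\<close>, the fifth \<open>N4\<close>.\<close>

abbreviation "NF1 \<equiv> level N1 <#> {\<one>}"
abbreviation "NF2 \<equiv> level N2 <#> NF1"
abbreviation "NF3 \<equiv> level N1' <#> NF2"
abbreviation "NF4 \<equiv> level N3 <#> NF3"
abbreviation "NF5 \<equiv> level N4 <#> NF4"

lemma level_closed: "level n \<subseteq> carrier G"
  by auto

lemma NF_closed:
  "NF1 \<subseteq> carrier G" "NF2 \<subseteq> carrier G" "NF3 \<subseteq> carrier G" "NF4 \<subseteq> carrier G" "NF5 \<subseteq> carrier G"
  using level_closed by (simp_all add: set_mult_closed)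

lemma NF5_mult_closed: "x \<in> NF5 \<Longrightarrow> g i \<otimes> x \<in> NF5"
proof -
  assume x: "x \<in> NF5"
  have "\<forall>i\<in>{N1}. \<forall>x\<in>NF1. g i \<otimes> x \<in> NF1"
    \<comment> \<open>At the bottom \<open>N1\<close> merely exchanges the two representatives, so
      no letter is passed on to \<open>{\<one>}\<close>.\<close>
    by (rule level_set_mult_closed[where J = "{}"]) (use reps_step(1)[OF one_closed] in auto)
  then have "\<forall>i\<in>{N1, N2}. \<forall>x\<in>NF2. g i \<otimes> x \<in> NF2"
    by (rule level_set_mult_closed[OF reps_step(2)[OF one_closed] NF_closed(1)])
  then have "\<forall>i\<in>{N1, N2, N1'}. \<forall>x\<in>NF3. g i \<otimes> x \<in> NF3"
    by (rule level_set_mult_closed[OF reps_step(3)[OF one_closed] NF_closed(2)])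
  then have "\<forall>i\<in>{N1, N2, N1', N3}. \<forall>x\<in>NF4. g i \<otimes> x \<in> NF4"
    by (rule level_set_mult_closed[OF reps_step(4)[OF one_closed] NF_closed(3)])
  then have "\<forall>i\<in>{N1, N2, N1', N3, N4}. \<forall>x\<in>NF5. g i \<otimes> x \<in> NF5"
    by (rule level_set_mult_closed[OF reps_step(5)[OF one_closed] NF_closed(4)])
  then show "g i \<otimes> x \<in> NF5"
    using x by (cases i) simp_all
qed

lemma one_in_level_set_mult: "\<one> \<in> N \<Longrightarrow> \<one> \<in> level n <#> N"
proof -
  assume "\<one> \<in> N"
  moreover have "\<one> \<in> level n"
    by (cases n) (auto simp: reps.simps)
  ultimately have "\<one> \<otimes> \<one> \<in> level n <#> N"
    unfolding set_mult_def by blast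
  then show ?thesis by simp
qed

lemma generate_eq_NF5: "generate G (range g) = NF5"
proof
  have g_range: "range g \<subseteq> carrier G" by auto
  show "generate G (range g) \<subseteq> NF5"
  proof
    fix x assume x: "x \<in> generate G (range g)"
    \<comment> \<open>The claim for all \<open>y\<close> survives the induction over products;
      \<open>y = \<one>\<close> then gives membership of \<open>x\<close>.\<close>
    have "\<forall>y\<in>NF5. x \<otimes> y \<in> NF5"
      using x
    proof (induction rule: generate.induct)
      case one
      then show ?case using NF_closed(5) by auto
    next
      case (incl h)
      then show ?case using NF5_mult_closed by auto
    next
      case (inv h)
      then show ?case using NF5_mult_closed by (auto simp: inv_g)
    next
      case (eng h1 h2)
      then have "h1 \<in> carrier G" "h2 \<in> carrier G"
        using g_range by (auto intro: generate_in_carrier)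
      then have "h1 \<otimes> h2 \<otimes> y = h1 \<otimes> (h2 \<otimes> y)" if "y \<in> NF5" for y
        using that NF_closed(5) by (auto intro: m_assoc)
      then show ?case
        using eng.IH by simp
    qed
    moreover have "\<one> \<in> NF5"
      by (intro one_in_level_set_mult singletonI)
    moreover have "x \<in> carrier G"
      using x g_range by (auto intro: generate_in_carrier)
    ultimately show "x \<in> NF5"
      by (metis r_one)
  qed
  have lmul_gen: "lmul w \<one> \<in> generate G (range g)" for w
    by (induction w) (auto intro: generate.intros)
  have "level n <#> N \<subseteq> generate G (range g)" if "N \<subseteq> generate G (range g)" for n N
    unfolding set_mult_def using that lmul_gen by (auto intro!: generate.eng)
  then show "NF5 \<subseteq> generate G (range g)"
    by (simp add: generate.one)
qed

end

section \<open>The matrix group\<close>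

lemma group_GL: "group (GL n)"
  unfolding GL_def by (rule monoid.units_group[OF ring.is_monoid[OF ring_mat]])

lemma GL_mult [simp]: "X \<otimes>\<^bsub>GL n\<^esub> Y = X * Y"
  and GL_one [simp]: "\<one>\<^bsub>GL n\<^esub> = 1\<^sub>m n"
  by (simp_all add: GL_def units_of_def ring_mat_simps)

lemma GL_carrierD: "X \<in> carrier (GL n) \<Longrightarrow> X \<in> carrier_mat n n"
  by (simp add: GL_def units_of_def ring_mat_simps Units_def)

lemma involution_in_GL: "X \<in> carrier_mat n n \<Longrightarrow> X * X = 1\<^sub>m n \<Longrightarrow> X \<in> carrier (GL n)"
  by (auto simp: GL_def units_of_def ring_mat_simps Units_def)

lemma mat_eqI_mult_vec:
  fixes X Y :: "'a :: semiring_1 mat"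
  assumes X: "X \<in> carrier_mat n m" and Y: "Y \<in> carrier_mat n m"
    and eq: "\<And>v. v \<in> carrier_vec m \<Longrightarrow> X *\<^sub>v v = Y *\<^sub>v v"
  shows "X = Y"
proof (rule eq_matI)
  fix i j assume "i < dim_row Y" "j < dim_col Y"
  then have ij: "i < n" "j < m" using Y by auto
  have "(X *\<^sub>v unit_vec m j) $ i = (Y *\<^sub>v unit_vec m j) $ i"
    using eq[of "unit_vec m j"] by simp
  then show "X $$ (i, j) = Y $$ (i, j)"
    using ij X Y by simp
qed (use X Y in auto)

text \<open>A vector with symbolic coordinates: matrix identities are checked by acting on it, where
  every generator is a simple substitution, instead of multiplying out entries.\<close>

definition vec7 ::
  "complex \<Rightarrow> complex \<Rightarrow> complex \<Rightarrow> complex \<Rightarrow> complex \<Rightarrow> complex \<Rightarrow> complex \<Rightarrow> complex vec" where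
  "vec7 x1 x2 x3 x4 x5 x6 x7 = vec_of_list [x1, x2, x3, x4, x5, x6, x7]"

lemma vec7_carrier [simp]: "vec7 x1 x2 x3 x4 x5 x6 x7 \<in> carrier_vec 7"
  unfolding vec7_def by (rule carrier_vecI) (simp del: vec_of_list_Cons)

lemma dim_vec7 [simp]: "dim_vec (vec7 x1 x2 x3 x4 x5 x6 x7) = 7"
  using carrier_vecD[OF vec7_carrier] .

lemma less_7_cases: "i < 7 \<Longrightarrow> i \<in> {0, 1, 2, 3, 4, 5, 6 :: nat}"
  by auto

lemma vec7_index:
  "vec7 x1 x2 x3 x4 x5 x6 x7 $ i = [x1, x2, x3, x4, x5, x6, x7] ! i"
  by (simp add: vec7_def vec_of_list_index del: vec_of_list_Cons)

lemma vec7_eqI: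
  assumes "v \<in> carrier_vec 7"
    and "v $ 0 = x1" "v $ 1 = x2" "v $ 2 = x3" "v $ 3 = x4" "v $ 4 = x5" "v $ 5 = x6" "v $ 6 = x7"
  shows "v = vec7 x1 x2 x3 x4 x5 x6 x7"
proof (rule eq_vecI)
  fix i assume "i < dim_vec (vec7 x1 x2 x3 x4 x5 x6 x7)"
  then have "i \<in> {0, 1, 2, 3, 4, 5, 6}"
    by (intro less_7_cases) simp
  then show "v $ i = vec7 x1 x2 x3 x4 x5 x6 x7 $ i"
    using assms(2-) by (auto simp: vec7_index)
qed (use assms(1) in simp)

lemma vec7_inject [simp]:
  "vec7 x1 x2 x3 x4 x5 x6 x7 = vec7 y1 y2 y3 y4 y5 y6 y7 \<longleftrightarrow>
     x1 = y1 \<and> x2 = y2 \<and> x3 = y3 \<and> x4 = y4 \<and> x5 = y5 \<and> x6 = y6 \<and> x7 = y7"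
  unfolding vec7_def by (metis list.inject list_vec)

lemma vec7_cases:
  assumes "v \<in> carrier_vec 7"
  obtains x1 x2 x3 x4 x5 x6 x7 where "v = vec7 x1 x2 x3 x4 x5 x6 x7"
  by (rule that[OF vec7_eqI[OF assms]]) simp_all

text \<open>
  The involution \<open>A\<close> has a two-dimensional \<open>(-1)\<close>-eigenspace, so it is not itself a Coxeter
  generator, but \<open>(34)A\<close> is a reflection.
\<close>

fun D5_mat :: "D5_node \<Rightarrow> complex mat" where
  "D5_mat N1 = perm_matrix 7 (transpose 1 2)"
| "D5_mat N2 = perm_matrix 7 (transpose 2 3)"
| "D5_mat N1' = perm_matrix 7 (transpose 3 4)"
| "D5_mat N3 = perm_matrix 7 (transpose 3 4) * A_matrix"
| "D5_mat N4 = perm_matrix 7 (transpose 6 7)"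

lemma perm_matrix_carrier [simp]: "perm_matrix n p \<in> carrier_mat n n"
  by (simp add: perm_matrix_def)

lemma A_matrix_carrier [simp]: "A_matrix \<in> carrier_mat 7 7"
  by (rule carrier_matI) (simp_all add: A_matrix_def mat_of_rows_list_def)

lemma D5_mat_carrier [simp]: "D5_mat i \<in> carrier_mat 7 7"
  by (cases i) (auto intro: mult_carrier_mat[of _ 7 7])

lemma sum_upto_7: "sum f {0..<7 :: nat} = f 0 + f 1 + f 2 + f 3 + f 4 + f 5 + f 6"
  by (simp add: eval_nat_numeral)

lemma mult_vec7_index:
  assumes "X \<in> carrier_mat 7 7" "i < 7"
  shows "(X *\<^sub>v vec7 x1 x2 x3 x4 x5 x6 x7) $ i =
    X $$ (i, 0) * x1 + X $$ (i, 1) * x2 + X $$ (i, 2) * x3 + X $$ (i, 3) * x4 +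
    X $$ (i, 4) * x5 + X $$ (i, 5) * x6 + X $$ (i, 6) * x7"
  using assms by (simp add: scalar_prod_def sum_upto_7 vec7_index)

lemma A_matrix_mult_vec7:
  "A_matrix *\<^sub>v vec7 x1 x2 x3 x4 x5 x6 x7 =
     vec7 x1 x2 (x7 - x3) (x7 - x4) (x5 + x7 - x3 - x4) (x6 + x7 - x3 - x4) x7"
  by (rule vec7_eqI)
    (simp_all add: mult_mat_vec_carrier[of _ 7 7] mult_vec7_index, simp_all add: A_matrix_def mat_of_rows_list_def)

lemma perm_matrix_mult_vec7:
  "perm_matrix 7 (transpose 1 2) *\<^sub>v vec7 x1 x2 x3 x4 x5 x6 x7 = vec7 x2 x1 x3 x4 x5 x6 x7"
  "perm_matrix 7 (transpose 2 3) *\<^sub>v vec7 x1 x2 x3 x4 x5 x6 x7 = vec7 x1 x3 x2 x4 x5 x6 x7"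
  "perm_matrix 7 (transpose 3 4) *\<^sub>v vec7 x1 x2 x3 x4 x5 x6 x7 = vec7 x1 x2 x4 x3 x5 x6 x7"
  "perm_matrix 7 (transpose 6 7) *\<^sub>v vec7 x1 x2 x3 x4 x5 x6 x7 = vec7 x1 x2 x3 x4 x5 x7 x6"
  by (rule vec7_eqI;
    simp add: mult_mat_vec_carrier[of _ 7 7] mult_vec7_index; simp add: perm_matrix_def transpose_def)+

lemma D5_mat_mult_vec7 [simp]:
  "D5_mat N1 *\<^sub>v vec7 x1 x2 x3 x4 x5 x6 x7 = vec7 x2 x1 x3 x4 x5 x6 x7"
  "D5_mat N2 *\<^sub>v vec7 x1 x2 x3 x4 x5 x6 x7 = vec7 x1 x3 x2 x4 x5 x6 x7"
  "D5_mat N1' *\<^sub>v vec7 x1 x2 x3 x4 x5 x6 x7 = vec7 x1 x2 x4 x3 x5 x6 x7"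
  "D5_mat N3 *\<^sub>v vec7 x1 x2 x3 x4 x5 x6 x7 =
     vec7 x1 x2 (x7 - x4) (x7 - x3) (x5 + x7 - x3 - x4) (x6 + x7 - x3 - x4) x7"
  "D5_mat N4 *\<^sub>v vec7 x1 x2 x3 x4 x5 x6 x7 = vec7 x1 x2 x3 x4 x5 x7 x6"
  by (simp_all add: perm_matrix_mult_vec7 A_matrix_mult_vec7 assoc_mult_mat_vec[of _ 7 7 _ 7]
    del: One_nat_def)

declare D5_mat.simps [simp del]

lemma mat7_eqI:
  assumes "X \<in> carrier_mat 7 7" "Y \<in> carrier_mat 7 7"
    and "\<And>x1 x2 x3 x4 x5 x6 x7. X *\<^sub>v vec7 x1 x2 x3 x4 x5 x6 x7 = Y *\<^sub>v vec7 x1 x2 x3 x4 x5 x6 x7"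
  shows "X = Y"
  using assms by (intro mat_eqI_mult_vec[of X 7 7]) (auto elim: vec7_cases)

lemmas mult_vec7_simps = assoc_mult_mat_vec[of _ 7 7 _ 7] mult_carrier_mat[of _ 7 7 _ 7]

lemma D5_mat_sq: "D5_mat i * D5_mat i = 1\<^sub>m 7"
  by (rule mat7_eqI) (cases i; simp add: mult_vec7_simps)+

lemma D5_mat_GL [simp]: "D5_mat i \<in> carrier (GL 7)"
  by (simp add: involution_in_GL D5_mat_sq)

lemma D5_mat_rel: "(D5_mat i \<otimes>\<^bsub>GL 7\<^esub> D5_mat j) [^]\<^bsub>GL 7\<^esub> D5_matrix i j = \<one>\<^bsub>GL 7\<^esub>"
proof -
  interpret GL: group "GL 7" by (rule group_GL)
  let ?X = "D5_mat i * D5_mat j"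
  have X: "?X \<in> carrier_mat 7 7"
    by (rule mult_carrier_mat[of _ 7 7]) simp_all
  have "?X = 1\<^sub>m 7" if "i = j"
    using that by (simp add: D5_mat_sq)
  moreover have "?X * ?X = 1\<^sub>m 7" if "D5_matrix i j = 2"
    by (rule mat7_eqI)
      (use that in \<open>cases i; cases j; simp add: mult_vec7_simps D5_matrix_def D5_edges_def doubleton_eq_iff\<close>)+
  moreover have "?X * ?X * ?X = 1\<^sub>m 7" if "D5_matrix i j = 3"
    by (rule mat7_eqI)
      (use that in \<open>cases i; cases j; simp add: mult_vec7_simps D5_matrix_def D5_edges_def doubleton_eq_iff\<close>)+
  moreover have "i = j \<and> D5_matrix i j = 1 \<or> D5_matrix i j = 2 \<or> D5_matrix i j = 3"
    by (simp add: D5_matrix_def)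
  ultimately show ?thesis
    using X by (auto simp: numeral_2_eq_2 numeral_3_eq_3 left_mult_one_mat[OF X])
qed

section \<open>Faithfulness\<close>

locale D5_matrix_rep = D5_generated +
  fixes h
  assumes hom: "h \<in> hom G (GL 7)" and h_g [simp]: "h (g i) = D5_mat i"
begin

lemma h_carrier: "x \<in> carrier G \<Longrightarrow> h x \<in> carrier_mat 7 7"
  using hom_in_carrier[OF hom] GL_carrierD by blast

lemma h_mult_vec:
  assumes "x \<in> carrier G" "y \<in> carrier G" "v \<in> carrier_vec 7"
  shows "h (x \<otimes> y) *\<^sub>v v = h x *\<^sub>v (h y *\<^sub>v v)"
  using assms by (simp add: hom_mult[OF hom] h_carrier assoc_mult_mat_vec[of _ 7 7 _ 7])

lemma h_one: "h \<one> = 1\<^sub>m 7"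
  using hom_one[OF hom is_group group_GL] by simp

text \<open>Reduces the orbit of a vector under the representatives to coordinate computations with
  \<open>D5_mat_mult_vec7\<close>.\<close>

lemma h_lmul_vec:
  assumes "v \<in> carrier_vec 7"
  shows "h (lmul w \<one>) *\<^sub>v v = foldr (\<lambda>i v. D5_mat i *\<^sub>v v) w v"
  using assms by (induction w) (simp_all add: h_one h_mult_vec)

definition fixing :: "complex vec \<Rightarrow> 'a set" where
  "fixing v = {x \<in> carrier G. h x *\<^sub>v v = v}"

lemma level_fixing:
  assumes "v \<in> carrier_vec 7" "\<forall>w\<in>set (reps n). \<forall>i\<in>set w. D5_mat i *\<^sub>v v = v"
  shows "level n \<subseteq> fixing v"
proof -
  have "foldr (\<lambda>i v. D5_mat i *\<^sub>v v) w v = v" if "\<forall>i\<in>set w. D5_mat i *\<^sub>v v = v" for w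
    using that by (induction w) auto
  then show ?thesis
    using assms by (auto simp: fixing_def h_lmul_vec)
qed

lemma set_mult_fixing:
  assumes "v \<in> carrier_vec 7" "A \<subseteq> fixing v" "B \<subseteq> fixing v"
  shows "A <#> B \<subseteq> fixing v"
  using assms by (force simp: fixing_def set_mult_def h_mult_vec)

lemma level_set_mult_inj:
  assumes v: "v \<in> carrier_vec 7" and N: "N \<subseteq> carrier G" "N \<subseteq> fixing v" "inj_on h N"
    and dist: "distinct (map (\<lambda>w. foldr (\<lambda>i v. D5_mat i *\<^sub>v v) w v) (reps n))"
  shows "inj_on h (level n <#> N) \<and> card (level n <#> N) = length (reps n) * card N"
proof -
  let ?ws = "map (\<lambda>w. lmul w \<one>) (reps n)"
  have "inj_on h (set ?ws <#> N) \<and> card (set ?ws <#> N) = length ?ws * card N"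
  proof (rule set_mult_transversal_inj[OF group_GL hom, where p = "\<lambda>X. X *\<^sub>v v"])
    fix w u assume "w \<in> set ?ws" "u \<in> N"
    then have "w \<in> carrier G" "u \<in> carrier G" "h u *\<^sub>v v = v"
      using N by (auto simp: fixing_def)
    then show "(h w \<otimes>\<^bsub>GL 7\<^esub> h u) *\<^sub>v v = h w *\<^sub>v v"
      using v by (simp add: h_carrier assoc_mult_mat_vec[of _ 7 7 _ 7])
  next
    show "distinct (map (\<lambda>w. h w *\<^sub>v v) ?ws)"
      using dist v by (simp add: h_lmul_vec comp_def)
  qed (use N in auto)
  then show ?thesis
    by simp
qed

lemma NF5_inj_card: "inj_on h NF5 \<and> card NF5 = 1920"
proof -
  have fixing_one: "{\<one>} \<subseteq> fixing v" if "v \<in> carrier_vec 7" for v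
    using that by (simp add: fixing_def h_one)
  \<comment> \<open>The first three stages permute the first four coordinates. The chosen basis
    vector is the last one that the new stage moves, so its images are basis vectors too.\<close>
  have 1: "inj_on h NF1 \<and> card NF1 = 2 * 1"
    using level_set_mult_inj[of "vec7 0 1 0 0 0 0 0" "{\<one>}" N1] fixing_one by (simp add: reps.simps(1))
  have "NF1 \<subseteq> fixing (vec7 0 0 1 0 0 0 0)"
    by (intro set_mult_fixing level_fixing fixing_one) (simp_all add: reps.simps)
  then have 2: "inj_on h NF2 \<and> card NF2 = 3 * 2"
    using level_set_mult_inj[of "vec7 0 0 1 0 0 0 0" NF1 N2] 1 NF_closed by (simp add: reps.simps(2))
  have "NF2 \<subseteq> fixing (vec7 0 0 0 1 0 0 0)"
    by (intro set_mult_fixing level_fixing fixing_one) (simp_all add: reps.simps)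
  then have 3: "inj_on h NF3 \<and> card NF3 = 4 * 6"
    using level_set_mult_inj[of "vec7 0 0 0 1 0 0 0" NF2 N1'] 2 NF_closed by (simp add: reps.simps(3))
  \<comment> \<open>The representatives send the seventh basis vector to itself, to the six vectors
    with two ones among the first four coordinates followed by \<open>1 1 1\<close>, and to
    \<open>(1,1,1,1,2,2,1)\<close>.\<close>
  have "NF3 \<subseteq> fixing (vec7 0 0 0 0 0 0 1)"
    by (intro set_mult_fixing level_fixing fixing_one) (simp_all add: reps.simps)
  then have 4: "inj_on h NF4 \<and> card NF4 = 8 * 24"
    using level_set_mult_inj[of "vec7 0 0 0 0 0 0 1" NF3 N3] 3 NF_closed by (simp add: reps.simps(4))
  \<comment> \<open>\<open>N4\<close> maps the sixth basis vector to the seventh. Its images are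
    therefore itself, the eight vectors of the previous stage, and
    \<open>(1,1,1,1,2,1,2)\<close>.\<close>
  have "NF4 \<subseteq> fixing (vec7 0 0 0 0 0 1 0)"
    by (intro set_mult_fixing level_fixing fixing_one) (simp_all add: reps.simps)
  then show ?thesis
    using level_set_mult_inj[of "vec7 0 0 0 0 0 1 0" NF4 N4] 4 NF_closed by (simp add: reps.simps(5))
qed

end

section \<open>The isomorphism\<close>

text \<open>Since the generators are involutions, a letter of either sign has the class of the
  positive letter, and induction on words applies.\<close>

lemma carrier_presented_group_eq_generate:
  assumes inv: "\<And>s. s \<in> S \<Longrightarrow> word_eq S R [(s, True), (s, True)] []"
  shows "carrier (presented_group S R) =
    generate (presented_group S R) ((\<lambda>s. word_rel S R `` {[(s, True)]}) ` S)"
    (is "_ = generate ?G ?K")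
proof
  interpret group ?G by (rule group_presented_group)
  have K: "?K \<subseteq> carrier ?G"
    by (auto simp: presented_group_def gen_words_def intro!: quotientI)
  show "generate ?G ?K \<subseteq> carrier ?G"
    by (rule generate_incl[OF K])
  have "word_rel S R `` {u} \<in> generate ?G ?K" if "u \<in> gen_words S" for u
    using that
  proof (induction u)
    case Nil
    then show ?case
      using generate.one[of ?G ?K] by (simp add: presented_group_def)
  next
    case (Cons p u)
    obtain s b where p: "p = (s, b)" by (cases p)
    have mem: "s \<in> S" "[(s, b)] \<in> gen_words S" "u \<in> gen_words S" "[(s, True)] \<in> gen_words S"
      using Cons.prems by (auto simp: p gen_words_def)
    \<comment> \<open>Insert the trivial word \<open>s s\<close> behind the inverse letter, then
      cancel that letter against the first \<open>s\<close>.\<close>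
    have "word_eq S R [(s, False)] [(s, True)]"
    proof (rule word_eq.trans)
      have "word_eq S R ([(s, False)] @ [(s, True), (s, True)]) ([(s, False)] @ [])"
        using mem by (intro word_eq_append_left inv) (auto simp: gen_words_def)
      then show "word_eq S R [(s, False)] [(s, False), (s, True), (s, True)]"
        by (auto intro: word_eq.sym)
      show "word_eq S R [(s, False), (s, True), (s, True)] [(s, True)]"
        using word_eq.cancel[of "[]" S "[(s, True)]" s R False] mem by (simp add: gen_words_def)
    qed
    then have "word_eq S R [(s, b)] [(s, True)]"
      using mem by (cases b) (auto intro: word_eq.refl)
    then have "word_rel S R `` {[(s, b)]} = word_rel S R `` {[(s, True)]}"
      by (intro equiv_class_eq[OF equiv_word_rel]) (simp add: word_rel_def)
    then have "word_rel S R `` {[(s, b)]} \<in> generate ?G ?K"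
      using mem by (auto intro: generate.incl)
    then have "word_rel S R `` {[(s, b)]} \<otimes>\<^bsub>?G\<^esub> word_rel S R `` {u} \<in> generate ?G ?K"
      using Cons.IH mem by (intro generate.eng)
    then show ?case
      using mem by (simp add: mult_presented_group p)
  qed
  then show "carrier ?G \<subseteq> generate ?G ?K"
    by (auto simp: presented_group_def elim!: quotientE)
qed

text \<open>The two generating sets differ only in \<open>A\<close> versus \<open>(34)A\<close>; as
  \<open>(34)\<close> is an involution lying in both, each generates the other.\<close>

lemma generate_D5_mat: "generate (GL 7) (range D5_mat) = generate (GL 7) G_L_gens"
proof -
  interpret GL: group "GL 7" by (rule group_GL)
  have "D5_mat N1' * D5_mat N3 = D5_mat N1' * D5_mat N1' * A_matrix"
    by (simp add: D5_mat.simps assoc_mult_mat[of _ 7 7 _ 7 _ 7])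
  then have A: "A_matrix = D5_mat N1' * D5_mat N3"
    by (simp add: D5_mat_sq left_mult_one_mat[of _ 7 7])
  have N3: "D5_mat N3 = D5_mat N1' * A_matrix"
    by (simp add: D5_mat.simps)
  have gens: "G_L_gens = {D5_mat N1, D5_mat N2, D5_mat N1', D5_mat N4, A_matrix}"
    by (simp add: G_L_gens_def D5_mat.simps)
  have A_GL: "A_matrix \<in> carrier (GL 7)"
    using GL.m_closed[of "D5_mat N1'" "D5_mat N3"] by (simp add: A)
  have "D5_mat i \<in> generate (GL 7) G_L_gens" for i
  proof (cases i)
    case N3
    show ?thesis
      using generate.eng[of "D5_mat N1'" "GL 7" G_L_gens A_matrix]
      by (simp add: N3 \<open>D5_mat N3 = D5_mat N1' * A_matrix\<close> gens generate.incl)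
  qed (auto simp: gens intro: generate.incl)
  moreover have "A_matrix \<in> generate (GL 7) (range D5_mat)"
    using generate.eng[of "D5_mat N1'" "GL 7" "range D5_mat" "D5_mat N3"]
    by (simp add: A generate.incl)
  then have "G_L_gens \<subseteq> generate (GL 7) (range D5_mat)"
    by (auto simp: gens intro: generate.incl)
  ultimately show ?thesis
    using A_GL
    by (intro equalityI GL.generate_subgroup_incl GL.generate_is_subgroup) (auto simp: gens)
qed

abbreviation D5_gen :: "D5_node \<Rightarrow> D5_node group_word set" where
  "D5_gen i \<equiv> word_rel UNIV (coxeter_relators UNIV D5_matrix) `` {[(i, True)]}"

abbreviation D5_rep :: "D5_node group_word set \<Rightarrow> complex mat" where
  "D5_rep \<equiv> presented_lift (GL 7) D5_mat"

lemma gen_words_UNIV [simp]: "u \<in> gen_words UNIV"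
  by (simp add: gen_words_def)

lemma coxeter_relator_eq_Nil:
  "word_eq UNIV (coxeter_relators UNIV m) (concat (replicate (m i j) [(i, True), (j, True)])) []"
proof -
  have "concat (replicate (m i j) [(i, True), (j, True)]) \<in> coxeter_relators UNIV m"
    by (auto simp: coxeter_relators_def)
  from word_eq.relator[OF _ _ this, of "[]" UNIV "[]"] show ?thesis
    by simp
qed

lemma D5_mat_relators:
  "r \<in> coxeter_relators UNIV D5_matrix \<Longrightarrow> word_eval (GL 7) D5_mat r = \<one>\<^bsub>GL 7\<^esub>"
  by (auto simp: coxeter_relators_def group.word_eval_replicate[OF group_GL] D5_mat_rel
    simp del: GL_mult GL_one)

text \<open>The relations hold in \<open>W_D5\<close> by construction and von Dyck's theorem
  supplies \<open>D5_rep\<close>, so normal forms and faithfulness become available for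
  \<open>W_D5\<close>.\<close>

interpretation W: D5_matrix_rep W_D5 D5_gen D5_rep
proof -
  interpret W: group W_D5
    unfolding W_D5_def coxeter_group_def by (rule group_presented_group)
  interpret GL: group "GL 7" by (rule group_GL)
  note lift = GL.presented_lift_hom[of D5_mat UNIV "coxeter_relators UNIV D5_matrix"]
    GL.presented_lift_class[of D5_mat UNIV "coxeter_relators UNIV D5_matrix"]
  show "D5_matrix_rep W_D5 D5_gen D5_rep"
  proof
    fix i j
    show "D5_gen i \<in> carrier W_D5"
      by (auto simp: W_D5_def coxeter_group_def presented_group_def intro!: quotientI)
    show "(D5_gen i \<otimes>\<^bsub>W_D5\<^esub> D5_gen j) [^]\<^bsub>W_D5\<^esub> D5_matrix i j = \<one>\<^bsub>W_D5\<^esub>"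
      unfolding W_D5_def coxeter_group_def word_class_pow[OF UNIV_I UNIV_I]
      by (simp add: presented_group_def, rule equiv_class_eq[OF equiv_word_rel])
        (simp add: word_rel_def coxeter_relator_eq_Nil)
    show "D5_rep \<in> hom W_D5 (GL 7)"
      unfolding W_D5_def coxeter_group_def by (rule lift) (simp_all add: D5_mat_relators)
    show "D5_rep (D5_gen i) = D5_mat i"
      by (subst lift(2)) (simp_all add: D5_mat_relators right_mult_one_mat[of _ 7 7])
  qed
qed

lemma carrier_W_D5: "carrier W_D5 = generate W_D5 (range D5_gen)"
  unfolding W_D5_def coxeter_group_def
proof (rule carrier_presented_group_eq_generate)
  fix s
  show "word_eq UNIV (coxeter_relators UNIV D5_matrix) [(s, True), (s, True)] []"
    \<comment> \<open>On the diagonal the exponent is 1, and the relator is already the word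
      \<open>s s\<close>.\<close>
    using coxeter_relator_eq_Nil[of D5_matrix s s] by (simp add: D5_matrix_def)
qed

theorem theorem4p1:
  shows "subgroup (carrier G_L) (GL 7) \<and> G_L \<cong> W_D5 \<and> order W_D5 = 1920"
proof (intro conjI)
  interpret GL: group "GL 7" by (rule group_GL)
  interpret h: group_hom W_D5 "GL 7" D5_rep
    by unfold_locales (rule W.hom)
  have "D5_rep ` range D5_gen = range D5_mat"
    by (simp add: image_image)
  \<comment> \<open>A homomorphism maps the subgroup generated by a set onto the subgroup generated
    by its image; this gives surjectivity onto \<open>G_L\<close>.\<close>
  then have img: "D5_rep ` carrier W_D5 = carrier G_L"
    using h.generate_img[of "range D5_gen"] W.g_closed
    by (simp add: carrier_W_D5[symmetric] G_L_def generate_D5_mat image_subset_iff)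
  \<comment> \<open>The normal forms exhaust the group, so injectivity and cardinality on
    \<open>NF5\<close> are statements about all of \<open>W_D5\<close>.\<close>
  have carrier: "carrier W_D5 = W.NF5"
    by (simp only: carrier_W_D5 W.generate_eq_NF5)
  show "subgroup (carrier G_L) (GL 7)"
    using h.img_is_subgroup by (simp add: img)
  show "order W_D5 = 1920"
    using W.NF5_inj_card by (simp add: order_def carrier)
  have "D5_rep \<in> iso W_D5 G_L"
  proof (rule isoI)
    show "D5_rep \<in> hom W_D5 G_L"
      using W.hom img by (auto simp: hom_def G_L_def)
    show "bij_betw D5_rep (carrier W_D5) (carrier G_L)"
      using W.NF5_inj_card by (simp add: bij_betw_def img carrier[symmetric])
  qed
  then show "G_L \<cong> W_D5"
    using W.iso_sym by (auto simp: is_iso_def)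
qed

end
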